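(* Let $J\ge 1$, let $\mathcal{H}_1,\ldots,\mathcal{H}_J$ be real finite-dimensional Hilbert spaces with $\mathcal{H}_J=\mathcal{H}$, and let $A$ be a self-adjoint positive definite (SPD) linear operator on $\mathcal{H}$. Let $I_k:\mathcal{H}_k\to\mathcal{H}$ and $I^k:\mathcal{H}\to\mathcal{H}_k$, $k=1,\ldots,J-1$, be linear operators with $\mathrm{null}(I_k)=\{0\}$ and $$I_1\mathcal{H}_1\subseteq I_2\mathcal{H}_2\subseteq\cdots\subseteq I_{J-1}\mathcal{H}_{J-1}\subseteq\mathcal{H}_J=\mathcal{H}.$$ Let $R_k$ be a linear operator on $\mathcal{H}_k$, $k=1,\ldots,J$, let $\omega>0$, and let $B$ be the additive multigrid operator on $\mathcal{H}$ defined by $$I - BA = I - \omega\,(I_1R_1I^1 + I_2R_2I^2+\cdots+I_{J-1}R_{J-1}I^{J-1}+R_J)A .$$ Suppose that 1. $I^k = c_k I_k^T$ with $c_k>0$, for $k=1,\ldots,J-1$; 2. $R_J$ is SPD on $\mathcal{H}$; 3. $R_k$ is symmetric (self-adjoint) and non-negative on $\mathcal{H}_k$ for $k=1,\ldots,J-1$. Then $B$ is self-adjoint and positive definite on $\mathcal{H}$.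
   Context: All inner products are written $(\cdot,\cdot)$; the inner products on the different spaces need not be related to each other. For a linear operator $N:\mathcal{H}_1'\to\mathcal{H}_2'$ between Hilbert spaces, $N^T:\mathcal{H}_2'\to\mathcal{H}_1'$ is the adjoint defined by $(Nu,v)_{\mathcal{H}_2'}=(u,N^Tv)_{\mathcal{H}_1'}$. An operator $M$ is positive definite if $(Mu,u)>0$ for all $u\ne0$, and non-negative if $(Mu,u)\ge0$ for all $u$; SPD means self-adjoint and positive definite. $I$ is the identity operator. *)

theory Defs
  imports Complex_Main "HOL-Library.FuncSet"
begin

text \<open>
  A space of a multilevel family is a finite-dimensional linear subspace \<open>V\<close> of an ambient real
  vector space, with an inner product \<open>ip\<close> of its own; values of \<open>ip\<close> outside \<open>V\<close> are irrelevant.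
  Completeness is automatic in finite dimension. A common ambient type costs no generality: any
  family of real vector spaces embeds into its direct sum.
\<close>

locale fin_dim_hilbert =
  fixes V :: "'a::real_vector set" and ip :: "'a \<Rightarrow> 'a \<Rightarrow> real"
  assumes subspace: "subspace V"
    and finite_dim: "\<exists>S. finite S \<and> V = span S"
    and ip_add_left: "\<lbrakk>u \<in> V; v \<in> V; w \<in> V\<rbrakk> \<Longrightarrow> ip (u + v) w = ip u w + ip v w"
    and ip_scale_left: "\<lbrakk>u \<in> V; w \<in> V\<rbrakk> \<Longrightarrow> ip (a *\<^sub>R u) w = a * ip u w"
    and ip_commute: "\<lbrakk>u \<in> V; v \<in> V\<rbrakk> \<Longrightarrow> ip u v = ip v u"
    and ip_pos: "\<lbrakk>u \<in> V; u \<noteq> 0\<rbrakk> \<Longrightarrow> ip u u > 0"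

definition linear_map_on ::
  "'a::real_vector set \<Rightarrow> 'b::real_vector set \<Rightarrow> ('a \<Rightarrow> 'b) \<Rightarrow> bool" where
  "linear_map_on V W N \<longleftrightarrow> N \<in> V \<rightarrow> W \<and>
     (\<forall>u\<in>V. \<forall>v\<in>V. N (u + v) = N u + N v) \<and>
     (\<forall>a. \<forall>u\<in>V. N (a *\<^sub>R u) = a *\<^sub>R N u)"

abbreviation linear_operator_on :: "'a::real_vector set \<Rightarrow> ('a \<Rightarrow> 'a) \<Rightarrow> bool" where
  "linear_operator_on V N \<equiv> linear_map_on V V N"

text \<open>
  The adjoint of \<open>N : V \<rightarrow> W\<close>. The description is well defined for linear \<open>N\<close>, see
  \<open>adjoint_on_in\<close> and \<open>adjoint_on_works\<close>.
\<close>

definition adjoint_on ::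
  "'a set \<Rightarrow> ('a \<Rightarrow> 'a \<Rightarrow> real) \<Rightarrow> 'b set \<Rightarrow> ('b \<Rightarrow> 'b \<Rightarrow> real) \<Rightarrow> ('a \<Rightarrow> 'b) \<Rightarrow> 'b \<Rightarrow> 'a" where
  "adjoint_on V ipV W ipW N w = (THE v. v \<in> V \<and> (\<forall>u\<in>V. ipW (N u) w = ipV u v))"

definition self_adjoint_on :: "'a set \<Rightarrow> ('a \<Rightarrow> 'a \<Rightarrow> real) \<Rightarrow> ('a \<Rightarrow> 'a) \<Rightarrow> bool" where
  "self_adjoint_on V ip N \<longleftrightarrow> (\<forall>v\<in>V. adjoint_on V ip V ip N v = N v)"

definition positive_definite_on ::
  "'a::real_vector set \<Rightarrow> ('a \<Rightarrow> 'a \<Rightarrow> real) \<Rightarrow> ('a \<Rightarrow> 'a) \<Rightarrow> bool" where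
  "positive_definite_on V ip N \<longleftrightarrow> (\<forall>u\<in>V. u \<noteq> 0 \<longrightarrow> ip (N u) u > 0)"

definition non_negative_on :: "'a set \<Rightarrow> ('a \<Rightarrow> 'a \<Rightarrow> real) \<Rightarrow> ('a \<Rightarrow> 'a) \<Rightarrow> bool" where
  "non_negative_on V ip N \<longleftrightarrow> (\<forall>u\<in>V. ip (N u) u \<ge> 0)"

definition SPD_on ::
  "'a::real_vector set \<Rightarrow> ('a \<Rightarrow> 'a \<Rightarrow> real) \<Rightarrow> ('a \<Rightarrow> 'a) \<Rightarrow> bool" where
  "SPD_on V ip N \<longleftrightarrow> self_adjoint_on V ip N \<and> positive_definite_on V ip N"

context fin_dim_hilbert
begin

lemma ip_add_right: "\<lbrakk>u \<in> V; v \<in> V; w \<in> V\<rbrakk> \<Longrightarrow> ip w (u + v) = ip w u + ip w v"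
  by (metis ip_add_left ip_commute subspace subspace_add)

lemma ip_scale_right: "\<lbrakk>u \<in> V; w \<in> V\<rbrakk> \<Longrightarrow> ip w (a *\<^sub>R u) = a * ip w u"
  by (metis ip_scale_left ip_commute subspace subspace_scale)

lemma ip_ext:
  assumes "v \<in> V" "w \<in> V" "\<And>u. u \<in> V \<Longrightarrow> ip u v = ip u w"
  shows "v = w"
proof (rule ccontr)
  assume "v \<noteq> w"
  define d where "d = v - w"
  have d: "d \<in> V" "d \<noteq> 0"
    using assms \<open>v \<noteq> w\<close> subspace by (auto simp: d_def subspace_diff)
  have "ip d v = ip d (w + d)" by (simp add: d_def)
  also have "\<dots> = ip d w + ip d d" using ip_add_right assms d by blast
  finally have "ip d d = 0" using assms(3)[OF d(1)] by simp
  with ip_pos[OF d] show False by simp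
qed

lemma riesz:
  assumes add: "\<And>u v. \<lbrakk>u \<in> V; v \<in> V\<rbrakk> \<Longrightarrow> f (u + v) = f u + f v"
    and scale: "\<And>a u. u \<in> V \<Longrightarrow> f (a *\<^sub>R u) = a * f u"
  shows "\<exists>v\<in>V. \<forall>u\<in>V. f u = ip u v"
proof -
  have main: "\<exists>v\<in>span S. \<forall>u\<in>span S. f u = ip u v"
    if "finite S" "S \<subseteq> V" and "\<And>u v. \<lbrakk>u \<in> V; v \<in> V\<rbrakk> \<Longrightarrow> f (u + v) = f u + f v"
      and "\<And>a u. u \<in> V \<Longrightarrow> f (a *\<^sub>R u) = a * f u" for S and f :: "'a \<Rightarrow> real"
    using that
  proof (induction S arbitrary: f rule: finite_induct)
    case empty
    have "0 \<in> V" using subspace by (rule subspace_0)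
    then have "f 0 = 0" "ip 0 0 = 0"
      using empty.prems(3)[of 0 0] ip_scale_left[of 0 0 0] by auto
    then show ?case by simp
  next
    case (insert a S)
    have sub: "span S \<subseteq> V" and aV: "a \<in> V"
      using insert.prems(1) span_minimal[OF _ subspace, of S] by auto
    have "\<exists>p\<in>span S. \<forall>u\<in>span S. ip u a = ip u p"
      using insert.IH[of "\<lambda>u. ip u a"] insert.prems(1) aV ip_add_left ip_scale_left by auto
    then obtain p where p: "p \<in> span S" "\<And>u. u \<in> span S \<Longrightarrow> ip u a = ip u p" by auto
    have "\<exists>q\<in>span S. \<forall>u\<in>span S. f u = ip u q"
      using insert.IH[of f] insert.prems by auto
    then obtain q where q: "q \<in> span S" "\<And>u. u \<in> span S \<Longrightarrow> f u = ip u q" by auto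
    define e where "e = a - p"
    have eV: "e \<in> V" using aV p sub subspace by (auto simp: e_def subspace_diff)
    have orth: "ip s e = 0" "ip e s = 0" if "s \<in> span S" for s
    proof -
      have "ip s a = ip s (p + e)" by (simp add: e_def)
      also have "\<dots> = ip s p + ip s e" using ip_add_right that p sub eV by blast
      finally show "ip s e = 0" using p(2)[OF that] by simp
      then show "ip e s = 0" using ip_commute that sub eV by auto
    qed
    define c where "c = (if e = 0 then 0 else f e / ip e e)"
    have f0: "f 0 = 0" using insert.prems(3)[of 0 0] subspace_0[OF subspace] by simp
    have e0: "ip e e \<noteq> 0" if "e \<noteq> 0" using ip_pos[OF eV that] by simp
    have i0: "ip 0 0 = 0" using ip_scale_left[of 0 0 0] subspace_0[OF subspace] by simp
    have ce: "f e = c * ip e e" using e0 f0 i0 by (auto simp: c_def)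
    have spanS: "span S \<subseteq> span (insert a S)" by (intro span_mono) auto
    have "e \<in> span (insert a S)"
      unfolding e_def using p(1) spanS by (intro span_diff) (auto intro: span_base)
    then have vin: "q + c *\<^sub>R e \<in> span (insert a S)"
      using q(1) spanS by (intro span_add span_scale) auto
    have "f u = ip u (q + c *\<^sub>R e)" if u: "u \<in> span (insert a S)" for u
    proof -
      from u obtain k where k: "u - k *\<^sub>R a \<in> span S" using span_breakdown_eq by blast
      define s where "s = (u - k *\<^sub>R a) + k *\<^sub>R p"
      have s: "s \<in> span S" unfolding s_def using k p(1) by (intro span_add span_scale)
      have V: "s \<in> V" "q \<in> V" "k *\<^sub>R e \<in> V" "c *\<^sub>R e \<in> V"
        using s q(1) sub eV subspace by (auto simp: subspace_scale)
      have us: "u = s + k *\<^sub>R e" by (simp add: s_def e_def algebra_simps)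
      have "f u = ip s q + k * (c * ip e e)"
        unfolding us using insert.prems(2)[OF V(1,3)] insert.prems(3)[OF eV] q(2)[OF s] ce by simp
      also have "\<dots> = ip u (q + c *\<^sub>R e)"
        unfolding us using V eV orth[OF s] orth[OF q(1)]
        by (simp add: ip_add_left ip_add_right ip_scale_left ip_scale_right
              subspace_add[OF subspace])
      finally show ?thesis .
    qed
    with vin show ?case by blast
  qed
  obtain S where S: "finite S" "V = span S" using finite_dim by blast
  show ?thesis using main[of S f] S add scale by (simp add: span_superset)
qed

end

lemma adjoint_on_ex1:
  assumes "fin_dim_hilbert V ipV" "fin_dim_hilbert W ipW" "linear_map_on V W N" "w \<in> W"
  shows "\<exists>!v. v \<in> V \<and> (\<forall>u\<in>V. ipW (N u) w = ipV u v)"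
proof -
  interpret V: fin_dim_hilbert V ipV by fact
  interpret W: fin_dim_hilbert W ipW by fact
  have "\<exists>v\<in>V. \<forall>u\<in>V. ipW (N u) w = ipV u v"
    using assms(3,4) by (intro V.riesz) (auto simp: linear_map_on_def W.ip_add_left W.ip_scale_left Pi_iff)
  then show ?thesis using V.ip_ext by metis
qed

lemma adjoint_on_in:
  assumes "fin_dim_hilbert V ipV" "fin_dim_hilbert W ipW" "linear_map_on V W N" "w \<in> W"
  shows "adjoint_on V ipV W ipW N w \<in> V"
  using theI'[OF adjoint_on_ex1[OF assms]] unfolding adjoint_on_def by blast

lemma adjoint_on_works:
  assumes "fin_dim_hilbert V ipV" "fin_dim_hilbert W ipW" "linear_map_on V W N" "u \<in> V" "w \<in> W"
  shows "ipW (N u) w = ipV u (adjoint_on V ipV W ipW N w)"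
  using theI'[OF adjoint_on_ex1[OF assms(1,2,3,5)]] assms(4) unfolding adjoint_on_def by blast

lemma self_adjoint_on_iff:
  assumes "fin_dim_hilbert V ip" "linear_operator_on V N"
  shows "self_adjoint_on V ip N \<longleftrightarrow> (\<forall>u\<in>V. \<forall>v\<in>V. ip (N u) v = ip u (N v))"
proof -
  interpret fin_dim_hilbert V ip by fact
  have N: "N v \<in> V" if "v \<in> V" for v using assms(2) that by (auto simp: linear_map_on_def)
  show ?thesis
    unfolding self_adjoint_on_def
    using adjoint_on_works[OF assms(1,1,2)] adjoint_on_in[OF assms(1,1,2)] N ip_ext by metis
qed

end

theory Submission imports Defs begin

text \<open>
  Since \<open>A\<close> is invertible, the hypothesis on \<open>I - BA\<close> determines \<open>B\<close> completely: every element of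
  the fine space has the form \<open>A u\<close> (\<open>SPD_on_surj\<close>), and cancelling gives
  \<open>B = \<omega> (\<Sum>k<J. I\<^sub>k R\<^sub>k I\<^sup>k + R\<^sub>J)\<close>. It then suffices to look at the bilinear form
  \<open>(v, w) \<mapsto> (B v, w)\<close>, term by term. Moving \<open>I\<^sub>k\<close> to the other side of the inner product turns it into
  \<open>I\<^sup>k / c\<^sub>k\<close>, so the term of level \<open>k\<close> contributes \<open>(R\<^sub>k I\<^sup>k v, I\<^sup>k w)\<^sub>k / c\<^sub>k\<close> (\<open>galerkin_form\<close>): it is the
  form of \<open>R\<^sub>k\<close> pulled back along \<open>I\<^sup>k\<close> and scaled by a positive number, hence symmetric and
  non-negative. The pull-back may be degenerate, because \<open>I\<^sup>k\<close> usually has a kernel; strict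
  positivity of the sum comes from the finest level \<open>R\<^sub>J\<close> alone.
\<close>

context fin_dim_hilbert
begin

lemma ip_sum_left:
  assumes "\<And>i. i \<in> K \<Longrightarrow> f i \<in> V" "w \<in> V"
  shows "ip (sum f K) w = (\<Sum>i\<in>K. ip (f i) w)"
proof -
  have zero: "ip 0 w = 0"
    using ip_scale_left[of 0 w 0] subspace_0[OF subspace] assms(2) by simp
  show ?thesis
    using assms(1)
  proof (induction K rule: infinite_finite_induct)
    case (insert i K)
    then show ?case
      using assms(2) subspace_sum[OF subspace, of K f] by (simp add: ip_add_left)
  qed (use zero in auto)
qed

text \<open>
  The form \<open>(N u, v)\<close> is itself an inner product on \<open>V\<close>. Representing the functional \<open>(\<cdot>, w)\<close> in it
  by some \<open>u\<close>, and moving \<open>N\<close> to the other side, gives \<open>N u = w\<close>; this replaces a dimension count.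
\<close>

lemma SPD_on_surj:
  assumes "linear_operator_on V N" "SPD_on V ip N" "w \<in> V"
  obtains u where "u \<in> V" "N u = w"
proof -
  have N: "N u \<in> V" if "u \<in> V" for u
    using assms(1) that by (auto simp: linear_map_on_def)
  have sym: "ip (N u) v = ip u (N v)" if "u \<in> V" "v \<in> V" for u v
    using assms(2) that self_adjoint_on_iff[OF fin_dim_hilbert_axioms assms(1)]
    by (auto simp: SPD_on_def)
  interpret energy: fin_dim_hilbert V "\<lambda>u v. ip (N u) v"
  proof
    show "ip (N (u + v)) z = ip (N u) z + ip (N v) z" if "u \<in> V" "v \<in> V" "z \<in> V" for u v z
      using assms(1) that N by (simp add: linear_map_on_def ip_add_left)
    show "ip (N (a *\<^sub>R u)) z = a * ip (N u) z" if "u \<in> V" "z \<in> V" for a u z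
      using assms(1) that N by (simp add: linear_map_on_def ip_scale_left)
    show "ip (N u) v = ip (N v) u" if "u \<in> V" "v \<in> V" for u v
      using that N sym ip_commute by metis
    show "ip (N u) u > 0" if "u \<in> V" "u \<noteq> 0" for u
      using assms(2) that by (auto simp: SPD_on_def positive_definite_on_def)
  qed (use subspace finite_dim in auto)
  obtain u where u: "u \<in> V" "\<And>v. v \<in> V \<Longrightarrow> ip v w = ip (N v) u"
    using energy.riesz[of "\<lambda>v. ip v w"] assms(3) ip_add_left ip_scale_left by auto
  have "N u = w"
    using ip_ext[OF N[OF u(1)] assms(3)] u sym by simp
  with u(1) show thesis by (rule that)
qed

end

text \<open>
  The adjoint of \<open>N\<close> is \<open>Q / c\<close>, so for \<open>c > 0\<close> the operator \<open>N S Q\<close> on the large space inherits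
  symmetry and sign from \<open>S\<close> on the small one.
\<close>

lemma galerkin_form:
  assumes V: "fin_dim_hilbert V ipV" and W: "fin_dim_hilbert W ipW"
    and N: "linear_map_on V W N" and S: "S \<in> V \<rightarrow> V" and c: "c \<noteq> 0"
    and Q: "\<And>w. w \<in> W \<Longrightarrow> Q w = c *\<^sub>R adjoint_on V ipV W ipW N w"
    and vw: "v \<in> W" "w \<in> W"
  shows "ipW (N (S (Q v))) w = ipV (S (Q v)) (Q w) / c"
proof -
  interpret V: fin_dim_hilbert V ipV by (rule V)
  have adj: "adjoint_on V ipV W ipW N z \<in> V" if "z \<in> W" for z
    using adjoint_on_in[OF V W N that] .
  have SQ: "S (Q v) \<in> V"
    using S Q[OF vw(1)] adj[OF vw(1)] subspace_scale[OF V.subspace] by auto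
  have "ipV (S (Q v)) (Q w) = c * ipW (N (S (Q v))) w"
    using adjoint_on_works[OF V W N SQ vw(2)] Q[OF vw(2)] V.ip_scale_right[OF adj[OF vw(2)] SQ]
    by simp
  then show ?thesis using c by simp
qed

theorem theorem4p7:
  fixes J :: nat
    and H :: "nat \<Rightarrow> 'a::real_vector set"
    and ip :: "nat \<Rightarrow> 'a \<Rightarrow> 'a \<Rightarrow> real"
    and A B :: "'a \<Rightarrow> 'a"
    and prolong restrict_op R :: "nat \<Rightarrow> 'a \<Rightarrow> 'a"
    and c :: "nat \<Rightarrow> real"
    and \<omega> :: real
  assumes J: "J \<ge> 1"
    and hilbert: "\<And>k. k \<in> {1..J} \<Longrightarrow> fin_dim_hilbert (H k) (ip k)"
    and A_linear: "linear_operator_on (H J) A"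
    and A_SPD: "SPD_on (H J) (ip J) A"
    and prolong_linear: "\<And>k. k \<in> {1..<J} \<Longrightarrow> linear_map_on (H k) (H J) (prolong k)"
    and restrict_linear: "\<And>k. k \<in> {1..<J} \<Longrightarrow> linear_map_on (H J) (H k) (restrict_op k)"
    and prolong_null: "\<And>k. k \<in> {1..<J} \<Longrightarrow> {u \<in> H k. prolong k u = 0} = {0}"
    and nested: "\<And>k. \<lbrakk>1 \<le> k; k + 1 < J\<rbrakk> \<Longrightarrow> prolong k ` H k \<subseteq> prolong (k + 1) ` H (k + 1)"
    and nested_top: "J \<ge> 2 \<Longrightarrow> prolong (J - 1) ` H (J - 1) \<subseteq> H J"
    and R_linear: "\<And>k. k \<in> {1..J} \<Longrightarrow> linear_operator_on (H k) (R k)"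
    and \<omega>_pos: "\<omega> > 0"
    and B_linear: "linear_operator_on (H J) B"
    and B_def: "\<And>u. u \<in> H J \<Longrightarrow>
      u - B (A u) =
      u - \<omega> *\<^sub>R ((\<Sum>k\<in>{1..<J}. prolong k (R k (restrict_op k (A u)))) + R J (A u))"
    and c_pos: "\<And>k. k \<in> {1..<J} \<Longrightarrow> c k > 0"
    and restrict_adjoint: "\<And>k v. \<lbrakk>k \<in> {1..<J}; v \<in> H J\<rbrakk> \<Longrightarrow>
      restrict_op k v = c k *\<^sub>R adjoint_on (H k) (ip k) (H J) (ip J) (prolong k) v"
    and RJ_SPD: "SPD_on (H J) (ip J) (R J)"
    and R_self_adjoint: "\<And>k. k \<in> {1..<J} \<Longrightarrow> self_adjoint_on (H k) (ip k) (R k)"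
    and R_non_negative: "\<And>k. k \<in> {1..<J} \<Longrightarrow> non_negative_on (H k) (ip k) (R k)"
  shows "SPD_on (H J) (ip J) B"
proof -
  have coarse: "k \<in> {1..J}" if "k \<in> {1..<J}" for k using that by auto
  interpret HJ: fin_dim_hilbert "H J" "ip J" using hilbert J by simp
  have RJ: "R J v \<in> H J" if "v \<in> H J" for v
    using R_linear[of J] J that by (auto simp: linear_map_on_def)
  have Rk: "R k \<in> H k \<rightarrow> H k" and Ik: "restrict_op k \<in> H J \<rightarrow> H k" and Pk: "prolong k \<in> H k \<rightarrow> H J"
    if "k \<in> {1..<J}" for k
    using R_linear[OF coarse[OF that]] restrict_linear[OF that] prolong_linear[OF that]
    by (auto simp: linear_map_on_def)
  define T where "T k v = prolong k (R k (restrict_op k v))" for k v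
  have T: "T k v \<in> H J" if "k \<in> {1..<J}" "v \<in> H J" for k v
    using Rk Ik Pk that unfolding T_def by blast
  have B: "B v = \<omega> *\<^sub>R ((\<Sum>k\<in>{1..<J}. T k v) + R J v)" if v: "v \<in> H J" for v
  proof -
    obtain u where "u \<in> H J" "A u = v" using HJ.SPD_on_surj[OF A_linear A_SPD v] .
    with B_def[of u] show ?thesis by (simp add: T_def)
  qed
  have B_form: "ip J (B v) w = \<omega> * ((\<Sum>k\<in>{1..<J}. ip J (T k v) w) + ip J (R J v) w)"
    if v: "v \<in> H J" and w: "w \<in> H J" for v w
  proof -
    have sum_in: "(\<Sum>k\<in>{1..<J}. T k v) \<in> H J"
      using T v by (intro subspace_sum[OF HJ.subspace]) auto
    have "ip J (\<Sum>k\<in>{1..<J}. T k v) w = (\<Sum>k\<in>{1..<J}. ip J (T k v) w)"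
      using T v w by (intro HJ.ip_sum_left) auto
    then show ?thesis
      using B[OF v] sum_in RJ[OF v] w
      by (simp add: HJ.ip_scale_left HJ.ip_add_left subspace_add[OF HJ.subspace])
  qed
  have T_form: "ip J (T k v) w = ip k (R k (restrict_op k v)) (restrict_op k w) / c k"
    if k: "k \<in> {1..<J}" and "v \<in> H J" "w \<in> H J" for k v w
    unfolding T_def
    using galerkin_form[OF hilbert[OF coarse[OF k]] HJ.fin_dim_hilbert_axioms prolong_linear[OF k]
        Rk[OF k] _ restrict_adjoint[OF k]] c_pos[OF k] that by simp
  have T_sym: "ip J (T k v) w = ip J (T k w) v"
    if k: "k \<in> {1..<J}" and v: "v \<in> H J" and w: "w \<in> H J" for k v w
  proof -
    interpret Hk: fin_dim_hilbert "H k" "ip k" using hilbert[OF coarse[OF k]] .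
    have Q: "restrict_op k v \<in> H k" "restrict_op k w \<in> H k" using Ik[OF k] v w by auto
    have "ip k (R k (restrict_op k v)) (restrict_op k w)
        = ip k (restrict_op k v) (R k (restrict_op k w))"
      using self_adjoint_on_iff[OF Hk.fin_dim_hilbert_axioms R_linear[OF coarse[OF k]]]
        R_self_adjoint[OF k] Q by blast
    also have "\<dots> = ip k (R k (restrict_op k w)) (restrict_op k v)"
      using Hk.ip_commute Q Rk[OF k] by blast
    finally show ?thesis using T_form k v w by simp
  qed
  have T_nonneg: "ip J (T k v) v \<ge> 0" if k: "k \<in> {1..<J}" and v: "v \<in> H J" for k v
    using T_form[OF k v v] R_non_negative[OF k] Ik[OF k] v c_pos[OF k]
    by (auto simp: non_negative_on_def intro!: divide_nonneg_pos)
  have RJ_sym: "ip J (R J v) w = ip J (R J w) v" if "v \<in> H J" "w \<in> H J" for v w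
    using RJ_SPD self_adjoint_on_iff[OF HJ.fin_dim_hilbert_axioms R_linear[of J]] J RJ that
      HJ.ip_commute by (auto simp: SPD_on_def)
  have "self_adjoint_on (H J) (ip J) B"
    unfolding self_adjoint_on_iff[OF HJ.fin_dim_hilbert_axioms B_linear]
  proof (intro ballI)
    fix v w assume v: "v \<in> H J" and w: "w \<in> H J"
    have "ip J (B v) w = ip J (B w) v"
      unfolding B_form[OF v w] B_form[OF w v] using T_sym RJ_sym v w by simp
    also have "\<dots> = ip J v (B w)"
      using HJ.ip_commute v w B_linear by (auto simp: linear_map_on_def)
    finally show "ip J (B v) w = ip J v (B w)" .
  qed
  moreover have "positive_definite_on (H J) (ip J) B"
    unfolding positive_definite_on_def
  proof (intro ballI impI)
    fix v assume v: "v \<in> H J" "v \<noteq> 0"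
    have "ip J (R J v) v > 0"
      using RJ_SPD v by (auto simp: SPD_on_def positive_definite_on_def)
    moreover have "(\<Sum>k\<in>{1..<J}. ip J (T k v) v) \<ge> 0"
      using T_nonneg v by (intro sum_nonneg) auto
    ultimately show "ip J (B v) v > 0"
      unfolding B_form[OF v(1) v(1)] using \<omega>_pos by simp
  qed
  ultimately show ?thesis by (simp add: SPD_on_def)
qed

end
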